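(* Let $f:\mathcal{S}\to\mathbb{R}$ be square-integrable with respect to the weight $w$, let $\mathcal{I}\subset\mathbb{N}^d$ be a finite set of multi-indices, and let $c:\mathcal{I}\to\mathbb{R}$ be the coefficient function of a sparse grid rule. Let $$\mathcal{A}_p(f)(s)=\sum_{\mathbf{m}\in\mathcal{I}} c(\mathbf{m})\,\big(\mathcal{U}_p^{m_1}\otimes\cdots\otimes\mathcal{U}_p^{m_d}\big)(f)(s)$$ be the sparse pseudospectral approximation, and let $$\mathcal{A}_l(f)(s)=\sum_{\mathbf{m}\in\mathcal{I}} c(\mathbf{m})\,\big(\mathcal{U}_l^{m_1}\otimes\cdots\otimes\mathcal{U}_l^{m_d}\big)(f)(s)$$ be the sparse grid interpolation approximation, both built from the same univariate Gaussian quadrature points, with the number of univariate basis polynomials in each variable of each tensor product equal to the number of univariate quadrature points. Then $\mathcal{A}_p(f)(s)=\mathcal{A}_l(f)(s)$ for all $s\in\mathcal{S}$.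
   Context: Domain and weight: $d\ge 1$, $\mathbb{N}=\{1,2,\dots\}$, $\mathcal{S}=\mathcal{S}_1\times\cdots\times\mathcal{S}_d\subset\mathbb{R}^d$ with each $\mathcal{S}_k\subset\mathbb{R}$ an interval. The weight is $w(s)=w_1(s_1)\cdots w_d(s_d)$, where each $w_k$ is positive on $\mathcal{S}_k$, satisfies $\int_{\mathcal{S}_k}w_k(s_k)\,ds_k=1$, and has finite moments of every order. Square-integrable means $\int_{\mathcal{S}} f(s)^2w(s)\,ds<\infty$; $f$ is a genuine function, with values at points. Orthonormal polynomials and Gaussian quadrature: for each $k$, fix univariate polynomials $\pi^{(k)}_1,\pi^{(k)}_2,\dots$, with $\pi^{(k)}_i$ of degree $i-1$, orthonormal with respect to $w_k$ on $\mathcal{S}_k$. For $n\ge1$, the $n$-point Gaussian quadrature rule for $w_k$ has as points $\lambda^{(k,n)}_1,\dots,\lambda^{(k,n)}_n$ the zeros of $\pi^{(k)}_{n+1}$ and as weights $\nu^{(k,n)}_j=1/\sum_{i=1}^n\pi^{(k)}_i(\lambda^{(k,n)}_j)^2$. The Lagrange cardinal functions on these points are $\ell^{(k,n)}_i(t)=\prod_{j\ne i}\frac{t-\lambda^{(k,n)}_j}{\lambda^{(k,n)}_i-\lambda^{(k,n)}_j}$. Growth rule: fix a nondecreasing sequence $(n_m)_{m\ge1}$ of positive integers; level $m$ in a variable uses $n_m$ quadrature points in that variable. For $\mathbf{m}=(m_1,\dots,m_d)\in\mathbb{N}^d$ let $\mathcal{I}_{\mathbf{m}}=\{\mathbf{i}\in\mathbb{N}^d: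 1\le i_k\le n_{m_k},\ k=1,\dots,d\}$, and for $\mathbf{i}\in\mathcal{I}_{\mathbf{m}}$ let $$\lambda_{\mathbf{i}}^{\mathbf{m}}=(\lambda^{(1,n_{m_1})}_{i_1},\dots,\lambda^{(d,n_{m_d})}_{i_d}),\quad \nu_{\mathbf{i}}^{\mathbf{m}}=\prod_{k=1}^d\nu^{(k,n_{m_k})}_{i_k},\quad \ell_{\mathbf{i}}^{\mathbf{m}}(s)=\prod_{k=1}^d\ell^{(k,n_{m_k})}_{i_k}(s_k),\quad \pi_{\mathbf{i}}(s)=\prod_{k=1}^d\pi^{(k)}_{i_k}(s_k).$$ Tensor product approximations: the tensor product Lagrange interpolation (spectral collocation) operator is $$(\mathcal{U}_l^{m_1}\otimes\cdots\otimes\mathcal{U}_l^{m_d})(f)(s)=\sum_{\mathbf{i}\in\mathcal{I}_{\mathbf{m}}}f(\lambda^{\mathbf{m}}_{\mathbf{i}})\,\ell^{\mathbf{m}}_{\mathbf{i}}(s),$$ and the tensor product pseudospectral operator is $$(\mathcal{U}_p^{m_1}\otimes\cdots\otimes\mathcal{U}_p^{m_d})(f)(s)=\sum_{\mathbf{i}\in\mathcal{I}_{\mathbf{m}}}\hat f_{\mathbf{i},\mathbf{m}}\,\pi_{\mathbf{i}}(s),\qquad \hat f_{\mathbf{i},\mathbf{m}}=\sum_{\mathbf{j}\in\mathcal{I}_{\mathbf{m}}}f(\lambda^{\mathbf{m}}_{\mathbf{j}})\,\pi_{\mathbf{i}}(\lambda^{\mathbf{m}}_{\mathbf{j}})\,\nu^{\mathbf{m}}_{\mathbf{j}}.$$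 *)

theory Defs
  imports "HOL-Analysis.Analysis" "HOL-Computational_Algebra.Polynomial"
begin

text \<open>
  The variables are indexed by a finite type \<open>'d\<close>, so \<open>d\<close> is \<open>CARD('d)\<close>, points are vectors
  in \<open>real ^ 'd\<close> and multi-indices are functions \<open>'d \<Rightarrow> nat\<close>. All indices start at 1; the
  value of a sequence at index 0 is never used. Integrals are Lebesgue integrals.
\<close>

definition weight_function :: "real set \<Rightarrow> (real \<Rightarrow> real) \<Rightarrow> bool" where
  "weight_function A w \<longleftrightarrow>
     (\<forall>t\<in>A. 0 < w t) \<and>
     (LINT t:A|lebesgue. w t) = 1 \<and>
     (\<forall>r::nat. set_integrable lebesgue A (\<lambda>t. t ^ r * w t))"

definition orthonormal_polys :: "real set \<Rightarrow> (real \<Rightarrow> real) \<Rightarrow> (nat \<Rightarrow> real poly) \<Rightarrow> bool" where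
  "orthonormal_polys A w p \<longleftrightarrow>
     (\<forall>i\<ge>1. degree (p i) = i - 1) \<and>
     (\<forall>i\<ge>1. \<forall>j\<ge>1. (LINT t:A|lebesgue. poly (p i) t * poly (p j) t * w t)
                      = (if i = j then 1 else 0))"

definition product_domain :: "('d::finite \<Rightarrow> real set) \<Rightarrow> (real ^ 'd) set" where
  "product_domain S = {s. \<forall>k. s $ k \<in> S k}"

definition product_weight :: "('d::finite \<Rightarrow> real \<Rightarrow> real) \<Rightarrow> real ^ 'd \<Rightarrow> real" where
  "product_weight w s = (\<Prod>k\<in>UNIV. w k (s $ k))"

definition square_integrable ::
  "('d::finite \<Rightarrow> real set) \<Rightarrow> ('d \<Rightarrow> real \<Rightarrow> real) \<Rightarrow> (real ^ 'd \<Rightarrow> real) \<Rightarrow> bool" where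
  "square_integrable S w f \<longleftrightarrow>
     set_integrable lebesgue (product_domain S) (\<lambda>s. (f s)\<^sup>2 * product_weight w s)"

text \<open>
  The sequence \<open>x 1, \<dots>, x n\<close> lists the zeros of \<open>p (n + 1)\<close>, in any order. That this polynomial
  has \<open>n\<close> real zeros, so that the \<open>x j\<close> are pairwise distinct, is not part of the definition.
\<close>

definition gauss_points :: "(nat \<Rightarrow> real poly) \<Rightarrow> nat \<Rightarrow> (nat \<Rightarrow> real) \<Rightarrow> bool" where
  "gauss_points p n x \<longleftrightarrow> x ` {1..n} = {t. poly (p (n + 1)) t = 0}"

definition gauss_weight :: "(nat \<Rightarrow> real poly) \<Rightarrow> nat \<Rightarrow> (nat \<Rightarrow> real) \<Rightarrow> nat \<Rightarrow> real" where
  "gauss_weight p n x j = 1 / (\<Sum>i=1..n. (poly (p i) (x j))\<^sup>2)"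

definition lagrange_cardinal :: "nat \<Rightarrow> (nat \<Rightarrow> real) \<Rightarrow> nat \<Rightarrow> real \<Rightarrow> real" where
  "lagrange_cardinal n x i t = (\<Prod>j\<in>{1..n} - {i}. (t - x j) / (x i - x j))"

text \<open>
  Below, \<open>N m\<close> is the number of quadrature points at level \<open>m\<close>, \<open>p k i\<close> is the \<open>i\<close>-th
  orthonormal polynomial in variable \<open>k\<close>, and \<open>x k n j\<close> is the \<open>j\<close>-th point of the
  \<open>n\<close>-point Gaussian rule in variable \<open>k\<close>.
\<close>

definition tensor_indices :: "(nat \<Rightarrow> nat) \<Rightarrow> ('d::finite \<Rightarrow> nat) \<Rightarrow> ('d \<Rightarrow> nat) set" where
  "tensor_indices N m = {i. \<forall>k. 1 \<le> i k \<and> i k \<le> N (m k)}"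

definition tensor_point ::
  "(nat \<Rightarrow> nat) \<Rightarrow> ('d::finite \<Rightarrow> nat \<Rightarrow> nat \<Rightarrow> real) \<Rightarrow> ('d \<Rightarrow> nat) \<Rightarrow> ('d \<Rightarrow> nat) \<Rightarrow> real ^ 'd" where
  "tensor_point N x m i = (\<chi> k. x k (N (m k)) (i k))"

definition tensor_weight ::
  "(nat \<Rightarrow> nat) \<Rightarrow> ('d::finite \<Rightarrow> nat \<Rightarrow> real poly) \<Rightarrow> ('d \<Rightarrow> nat \<Rightarrow> nat \<Rightarrow> real) \<Rightarrow>
    ('d \<Rightarrow> nat) \<Rightarrow> ('d \<Rightarrow> nat) \<Rightarrow> real" where
  "tensor_weight N p x m i = (\<Prod>k\<in>UNIV. gauss_weight (p k) (N (m k)) (x k (N (m k))) (i k))"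

definition tensor_cardinal ::
  "(nat \<Rightarrow> nat) \<Rightarrow> ('d::finite \<Rightarrow> nat \<Rightarrow> nat \<Rightarrow> real) \<Rightarrow> ('d \<Rightarrow> nat) \<Rightarrow> ('d \<Rightarrow> nat) \<Rightarrow>
    real ^ 'd \<Rightarrow> real" where
  "tensor_cardinal N x m i s =
     (\<Prod>k\<in>UNIV. lagrange_cardinal (N (m k)) (x k (N (m k))) (i k) (s $ k))"

definition tensor_poly ::
  "('d::finite \<Rightarrow> nat \<Rightarrow> real poly) \<Rightarrow> ('d \<Rightarrow> nat) \<Rightarrow> real ^ 'd \<Rightarrow> real" where
  "tensor_poly p i s = (\<Prod>k\<in>UNIV. poly (p k (i k)) (s $ k))"

definition tensor_interpolation ::
  "(nat \<Rightarrow> nat) \<Rightarrow> ('d::finite \<Rightarrow> nat \<Rightarrow> nat \<Rightarrow> real) \<Rightarrow> ('d \<Rightarrow> nat) \<Rightarrow>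
    (real ^ 'd \<Rightarrow> real) \<Rightarrow> real ^ 'd \<Rightarrow> real" where
  "tensor_interpolation N x m f s =
     (\<Sum>i\<in>tensor_indices N m. f (tensor_point N x m i) * tensor_cardinal N x m i s)"

definition pseudospectral_coeff ::
  "(nat \<Rightarrow> nat) \<Rightarrow> ('d::finite \<Rightarrow> nat \<Rightarrow> real poly) \<Rightarrow> ('d \<Rightarrow> nat \<Rightarrow> nat \<Rightarrow> real) \<Rightarrow>
    ('d \<Rightarrow> nat) \<Rightarrow> (real ^ 'd \<Rightarrow> real) \<Rightarrow> ('d \<Rightarrow> nat) \<Rightarrow> real" where
  "pseudospectral_coeff N p x m f i =
     (\<Sum>j\<in>tensor_indices N m.
        f (tensor_point N x m j) * tensor_poly p i (tensor_point N x m j) * tensor_weight N p x m j)"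

definition tensor_pseudospectral ::
  "(nat \<Rightarrow> nat) \<Rightarrow> ('d::finite \<Rightarrow> nat \<Rightarrow> real poly) \<Rightarrow> ('d \<Rightarrow> nat \<Rightarrow> nat \<Rightarrow> real) \<Rightarrow>
    ('d \<Rightarrow> nat) \<Rightarrow> (real ^ 'd \<Rightarrow> real) \<Rightarrow> real ^ 'd \<Rightarrow> real" where
  "tensor_pseudospectral N p x m f s =
     (\<Sum>i\<in>tensor_indices N m. pseudospectral_coeff N p x m f i * tensor_poly p i s)"

definition sparse_pseudospectral ::
  "(nat \<Rightarrow> nat) \<Rightarrow> ('d::finite \<Rightarrow> nat \<Rightarrow> real poly) \<Rightarrow> ('d \<Rightarrow> nat \<Rightarrow> nat \<Rightarrow> real) \<Rightarrow>
    ('d \<Rightarrow> nat) set \<Rightarrow> (('d \<Rightarrow> nat) \<Rightarrow> real) \<Rightarrow> (real ^ 'd \<Rightarrow> real) \<Rightarrow> real ^ 'd \<Rightarrow> real" where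
  "sparse_pseudospectral N p x I c f s = (\<Sum>m\<in>I. c m * tensor_pseudospectral N p x m f s)"

definition sparse_interpolation ::
  "(nat \<Rightarrow> nat) \<Rightarrow> ('d::finite \<Rightarrow> nat \<Rightarrow> nat \<Rightarrow> real) \<Rightarrow>
    ('d \<Rightarrow> nat) set \<Rightarrow> (('d \<Rightarrow> nat) \<Rightarrow> real) \<Rightarrow> (real ^ 'd \<Rightarrow> real) \<Rightarrow> real ^ 'd \<Rightarrow> real" where
  "sparse_interpolation N x I c f s = (\<Sum>m\<in>I. c m * tensor_interpolation N x m f s)"

end

theory Submission imports Defs begin

text \<open>
  Both operators are linear in the point values of \<open>f\<close> and factor over the variables, so everything
  reduces to the univariate identity
  \<open>gauss_weight j * (\<Sum>i=1..n. p i (x j) * p i t) = lagrange_cardinal j t\<close>.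
  Let \<open>a\<close> be a zero of \<open>p (n + 1)\<close> and \<open>g = p (n + 1) / (X - a)\<close>. For \<open>v\<close> of degree less than \<open>n\<close>,
  \<open>v - v(a)\<close> is a multiple of \<open>X - a\<close>, so orthogonality of \<open>p (n + 1)\<close> gives \<open>\<integral>g v w = v(a) \<integral>g w\<close>.
  Hence the orthonormal expansion of \<open>g\<close> is a multiple of \<open>\<Sum>i. p i (a) p i\<close>, and normalising both
  sides to the value 1 at \<open>a\<close> gives the identity. That \<open>p (n + 1)\<close> has \<open>n\<close> distinct real zeros
  follows by pairing it with a polynomial whose product with it does not change sign.
\<close>

section \<open>Integrals of polynomials against the weight\<close>

definition weighted_integral :: "real set \<Rightarrow> (real \<Rightarrow> real) \<Rightarrow> real poly \<Rightarrow> real" where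
  "weighted_integral A w g = (LINT t:A|lebesgue. poly g t * w t)"

lemma weight_function_poly_integrable:
  assumes "weight_function A w"
  shows "set_integrable lebesgue A (\<lambda>t. poly g t * w t)"
proof -
  have m: "set_integrable lebesgue A (\<lambda>t. t ^ r * w t)" for r
    using assms by (simp add: weight_function_def)
  have "set_integrable lebesgue A (\<lambda>t. \<Sum>i\<le>degree g. coeff g i * (t ^ i * w t))"
    using m unfolding set_integrable_def scaleR_sum_right
    by (intro Bochner_Integration.integrable_sum) (simp add: mult.left_commute[of _ "coeff g _"])
  then show ?thesis
    by (simp add: poly_altdef sum_distrib_right mult.assoc)
qed

lemma weighted_integral_add:
  assumes "weight_function A w"
  shows "weighted_integral A w (g + h) = weighted_integral A w g + weighted_integral A w h"
  using set_integral_add(2)[OF weight_function_poly_integrable[OF assms, of g]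
      weight_function_poly_integrable[OF assms, of h]]
  by (simp add: weighted_integral_def algebra_simps)

lemma weighted_integral_smult:
  "weighted_integral A w (smult c g) = c * weighted_integral A w g"
  by (simp add: weighted_integral_def mult.assoc)

lemma weighted_integral_sum:
  assumes "weight_function A w"
  shows "weighted_integral A w (\<Sum>i\<in>J. g i) = (\<Sum>i\<in>J. weighted_integral A w (g i))"
proof (induction J rule: infinite_finite_induct)
  case (insert i J)
  then show ?case by (simp add: weighted_integral_add[OF assms])
qed (simp_all add: weighted_integral_def)

text \<open>A nonnegative integrand with integral 0 vanishes almost everywhere. Since
  \<open>g\<close> has only finitely many roots, \<open>w\<close> itself would then vanish almost
  everywhere on \<open>A\<close>, against its total mass 1.\<close>

lemma weighted_integral_nonneg_neq_0:
  assumes w: "weight_function A w" and "g \<noteq> 0" and nonneg: "\<And>t. 0 \<le> poly g t"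
  shows "weighted_integral A w g \<noteq> 0"
proof
  assume 0: "weighted_integral A w g = 0"
  have pos: "0 < w t" if "t \<in> A" for t
    using w that by (simp add: weight_function_def)
  have int: "integrable lebesgue (\<lambda>t. indicator A t *\<^sub>R (poly g t * w t))"
    using weight_function_poly_integrable[OF w] by (simp add: set_integrable_def)
  have ge: "0 \<le> indicator A t *\<^sub>R (poly g t * w t)" for t
    using nonneg[of t] pos[of t] by (auto simp: indicator_def)
  have "AE t in lebesgue. indicator A t *\<^sub>R (poly g t * w t) = 0"
    using integral_nonneg_eq_0_iff_AE[OF int] ge 0
    by (simp add: weighted_integral_def set_lebesgue_integral_def)
  moreover have "AE t in lebesgue. t \<notin> {t. poly g t = 0}"
    using negligible_finite[OF poly_roots_finite[OF \<open>g \<noteq> 0\<close>]]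
    by (intro AE_not_in) (simp add: negligible_iff_null_sets)
  ultimately have "AE t in lebesgue. indicator A t *\<^sub>R w t = 0"
    by eventually_elim (auto simp: indicator_def)
  then have "(LINT t:A|lebesgue. w t) = 0"
    unfolding set_lebesgue_integral_def by (rule integral_eq_zero_AE)
  then show False using w by (simp add: weight_function_def)
qed

section \<open>Real roots, sign changes and linear factors\<close>

lemma poly_rootfree_const_sign:
  fixes q :: "real poly"
  assumes "\<And>t. poly q t \<noteq> 0"
  shows "(\<forall>t. 0 \<le> poly q t) \<or> (\<forall>t. poly q t \<le> 0)"
proof (rule ccontr)
  assume "\<not> ?thesis"
  then obtain a b where ab: "poly q a < 0" "0 < poly q b" by (auto simp: not_le)
  then have "a \<noteq> b" by auto
  then show False
    using poly_IVT_pos[of a b q] poly_IVT_neg[of b a q] ab assms by (metis linorder_neqE)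
qed

text \<open>\<open>A\<close> is the set of roots of odd multiplicity, but the induction needs no multiplicities.\<close>

lemma ex_roots_product_const_sign:
  fixes q :: "real poly"
  assumes "q \<noteq> 0"
  obtains A where "finite A" "A \<subseteq> {t. poly q t = 0}"
    "(\<forall>t. 0 \<le> poly (q * (\<Prod>a\<in>A. [:-a, 1:])) t) \<or> (\<forall>t. poly (q * (\<Prod>a\<in>A. [:-a, 1:])) t \<le> 0)"
proof -
  have "\<exists>A. finite A \<and> A \<subseteq> {t. poly q t = 0} \<and>
    ((\<forall>t. 0 \<le> poly (q * (\<Prod>a\<in>A. [:-a, 1:])) t) \<or> (\<forall>t. poly (q * (\<Prod>a\<in>A. [:-a, 1:])) t \<le> 0))"
    using assms
  proof (induction "degree q" arbitrary: q rule: less_induct)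
    case less
    show ?case
    proof (cases "\<exists>a. poly q a = 0")
      case False
      then show ?thesis
        using poly_rootfree_const_sign[of q] by (intro exI[of _ "{}"]) auto
    next
      case True
      then obtain a h where q: "q = [:-a, 1:] * h"
        by (metis poly_eq_0_iff_dvd dvdE)
      with less.prems have h: "h \<noteq> 0" by auto
      then have "degree q = Suc (degree h)"
        unfolding q by (subst degree_mult_eq) auto
      then obtain B where B: "finite B" "B \<subseteq> {t. poly h t = 0}"
        "(\<forall>t. 0 \<le> poly (h * (\<Prod>a\<in>B. [:-a, 1:])) t) \<or> (\<forall>t. poly (h * (\<Prod>a\<in>B. [:-a, 1:])) t \<le> 0)"
        using less.hyps[of h] h by auto
      \<comment> \<open>If \<open>a\<close> is in \<open>B\<close>, the factor X - a of
        \<open>q\<close> takes over from the one in the product, so \<open>a\<close> is dropped.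
        Otherwise \<open>a\<close> is added, and the resulting square of X - a leaves the sign
        unchanged.\<close>
      show ?thesis
      proof (cases "a \<in> B")
        case True
        then have "q * (\<Prod>b\<in>B - {a}. [:-b, 1:]) = h * (\<Prod>b\<in>B. [:-b, 1:])"
          using B(1) by (simp only: q prod.remove mult_ac)
        moreover have "B - {a} \<subseteq> {t. poly q t = 0}" using B(2) by (auto simp: q)
        ultimately show ?thesis
          using B(1,3) by (intro exI[of _ "B - {a}"]) auto
      next
        case False
        then have "q * (\<Prod>b\<in>insert a B. [:-b, 1:]) = [:-a, 1:]\<^sup>2 * (h * (\<Prod>b\<in>B. [:-b, 1:]))"
          using B(1) by (simp only: q prod.insert power2_eq_square mult_ac not_False_eq_True)
        then have *: "poly (q * (\<Prod>b\<in>insert a B. [:-b, 1:])) t =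
            (t - a)\<^sup>2 * poly (h * (\<Prod>b\<in>B. [:-b, 1:])) t" for t
          by (simp only: poly_mult poly_power) simp
        have "insert a B \<subseteq> {t. poly q t = 0}" using B(2) by (auto simp: q)
        moreover have "(\<forall>t. 0 \<le> poly (q * (\<Prod>b\<in>insert a B. [:-b, 1:])) t) \<or>
            (\<forall>t. poly (q * (\<Prod>b\<in>insert a B. [:-b, 1:])) t \<le> 0)"
          unfolding * using B(3) by (meson mult_nonneg_nonneg mult_nonneg_nonpos zero_le_power2)
        ultimately show ?thesis
          using B(1) by (intro exI[of _ "insert a B"]) simp
      qed
    qed
  qed
  with that show thesis by blast
qed

text \<open>The points are distinct, so a new point is no root of the product built so far and must
  be a root of the cofactor.\<close>

lemma prod_linear_factors_dvd:
  fixes q :: "'a::idom poly"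
  assumes "finite J" "inj_on x J" "\<And>j. j \<in> J \<Longrightarrow> poly q (x j) = 0"
  shows "(\<Prod>j\<in>J. [:- x j, 1:]) dvd q"
  using assms
proof (induction J)
  case (insert a J)
  then obtain h where h: "q = (\<Prod>j\<in>J. [:- x j, 1:]) * h" by (auto elim: dvdE)
  have "poly (\<Prod>j\<in>J. [:- x j, 1:]) (x a) \<noteq> 0"
    using insert.hyps insert.prems(1) by (auto simp: poly_prod)
  then have "poly h (x a) = 0" using insert.prems(2)[of a] h by simp
  then have "[:- x a, 1:] dvd h" by (simp add: poly_eq_0_iff_dvd)
  then show ?case
    using insert.hyps
    by (simp add: h mult.commute[of "[:- x a, 1:]"] mult_dvd_mono
        del: mult_pCons_left mult_pCons_right)
qed simp

section \<open>Orthonormal polynomials and Gauss points in one variable\<close>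

locale orthonormal_system =
  fixes A :: "real set" and w :: "real \<Rightarrow> real" and p :: "nat \<Rightarrow> real poly"
  assumes weight: "weight_function A w"
    and orthonormal: "orthonormal_polys A w p"
begin

abbreviation "L \<equiv> weighted_integral A w"

lemma degree_p: "1 \<le> i \<Longrightarrow> degree (p i) = i - 1"
  using orthonormal by (simp add: orthonormal_polys_def)

lemma L_p_mult_p: "1 \<le> i \<Longrightarrow> 1 \<le> j \<Longrightarrow> L (p i * p j) = (if i = j then 1 else 0)"
  using orthonormal by (simp add: orthonormal_polys_def weighted_integral_def)

text \<open>The unit norm excludes the zero polynomial. The degree condition alone does not at
  \<open>i = 1\<close>, since the zero polynomial also has degree 0.\<close>

lemma p_neq_0: "1 \<le> i \<Longrightarrow> p i \<noteq> 0"
  using L_p_mult_p[of i i] by (auto simp: weighted_integral_def)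

lemma in_span_p:
  assumes "degree g < n"
  shows "\<exists>c. g = (\<Sum>i=1..n. smult (c i) (p i))"
  using assms
proof (induction n arbitrary: g)
  case (Suc n)
  \<comment> \<open>\<open>p (Suc n)\<close> has degree exactly \<open>n\<close>, so this multiple
    of it cancels the coefficient of \<open>g\<close> at \<open>n\<close>.\<close>
  define b where "b = coeff g n / coeff (p (Suc n)) n"
  define h where "h = g - smult b (p (Suc n))"
  have deg: "degree (p (Suc n)) = n" using degree_p[of "Suc n"] by simp
  then have "coeff (p (Suc n)) n \<noteq> 0" 
    using p_neq_0[of "Suc n"] leading_coeff_0_iff[of "p (Suc n)"] by simp
  then have "coeff h n = 0" by (simp add: h_def b_def)
  moreover have "degree h \<le> n"
    unfolding h_def using Suc.prems deg by (intro degree_diff_le) auto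
  \<comment> \<open>The case \<open>h = 0\<close> stands apart because the zero polynomial has
    degree 0, which is not below \<open>n\<close> when \<open>n = 0\<close>.\<close>
  ultimately have h: "h = 0 \<or> degree h < n"
    by (metis le_neq_implies_less leading_coeff_0_iff)
  have "\<exists>c. h = (\<Sum>i=1..n. smult (c i) (p i))"
  proof (cases "h = 0")
    case True
    then show ?thesis by (intro exI[of _ "\<lambda>_. 0"]) simp
  qed (use h Suc.IH in auto)
  then obtain c where c: "h = (\<Sum>i=1..n. smult (c i) (p i))" by blast
  have "g = (\<Sum>i=1..n. smult (c i) (p i)) + smult b (p (Suc n))"
    using c by (simp add: h_def algebra_simps)
  also have "\<dots> = (\<Sum>i=1..Suc n. smult ((c(Suc n := b)) i) (p i))"
    by (simp add: sum.nat_ivl_Suc')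
  finally show ?case by blast
qed simp

lemma expansion:
  assumes "degree g < n"
  shows "g = (\<Sum>i=1..n. smult (L (g * p i)) (p i))"
proof -
  obtain c where c: "g = (\<Sum>i=1..n. smult (c i) (p i))" using in_span_p[OF assms] by blast
  have "L (g * p j) = c j" if "j \<in> {1..n}" for j
  proof -
    have "L (g * p j) = (\<Sum>i=1..n. c i * L (p i * p j))"
      by (simp add: c sum_distrib_right weighted_integral_sum[OF weight] weighted_integral_smult)
    also have "\<dots> = (\<Sum>i=1..n. if i = j then c i else 0)"
      using that by (intro sum.cong) (auto simp: L_p_mult_p)
    finally show ?thesis using that by simp
  qed
  then show ?thesis using c by simp
qed

lemma orthogonal_lower_degree:
  assumes "degree g < n"
  shows "L (p (n + 1) * g) = 0"
proof -
  obtain c where "g = (\<Sum>i=1..n. smult (c i) (p i))" using in_span_p[OF assms] by blast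
  then show ?thesis
    by (simp add: sum_distrib_left weighted_integral_sum[OF weight] weighted_integral_smult
        L_p_mult_p del: One_nat_def)
qed

text \<open>With fewer than \<open>n\<close> roots, the multiplier \<open>r\<close> has at most one
  linear factor per root, hence degree below \<open>n\<close>, and is orthogonal to
  \<open>p (n + 1)\<close>. But their product is nonzero and of constant sign, so its integral
  cannot vanish.\<close>

lemma card_roots_p: "card {t. poly (p (n + 1)) t = 0} \<ge> n"
proof (rule ccontr)
  assume less: "\<not> ?thesis"
  have q: "p (n + 1) \<noteq> 0" by (rule p_neq_0) simp
  obtain B where B: "finite B" "B \<subseteq> {t. poly (p (n + 1)) t = 0}"
    "(\<forall>t. 0 \<le> poly (p (n + 1) * (\<Prod>a\<in>B. [:-a, 1:])) t) \<or>
     (\<forall>t. poly (p (n + 1) * (\<Prod>a\<in>B. [:-a, 1:])) t \<le> 0)"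
    using ex_roots_product_const_sign[OF q] by blast
  define r where "r = (\<Prod>a\<in>B. [:-a, 1:])"
  have "degree r = card B"
    unfolding r_def by (subst degree_prod_eq_sum_degree) auto
  also have "\<dots> \<le> card {t. poly (p (n + 1)) t = 0}"
    using B(2) poly_roots_finite[OF q] by (intro card_mono)
  finally have "degree r < n" using less by simp
  then have L0: "L (p (n + 1) * r) = 0" by (rule orthogonal_lower_degree)
  have nz: "p (n + 1) * r \<noteq> 0" using q B(1) by (simp add: r_def)
  from B(3) show False
  proof
    assume "\<forall>t. 0 \<le> poly (p (n + 1) * (\<Prod>a\<in>B. [:-a, 1:])) t"
    then show False
      using weighted_integral_nonneg_neq_0[OF weight nz] L0 by (simp add: r_def)
  next
    assume "\<forall>t. poly (p (n + 1) * (\<Prod>a\<in>B. [:-a, 1:])) t \<le> 0"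
    then show False
      using weighted_integral_nonneg_neq_0[OF weight, of "smult (-1) (p (n + 1) * r)"] nz L0
      unfolding weighted_integral_smult by (simp add: r_def)
  qed
qed

text \<open>\<open>n\<close> indices cover at least \<open>n\<close> roots, so no two points
  coincide.\<close>

lemma inj_on_gauss_points:
  assumes "gauss_points p n x"
  shows "inj_on x {1..n}"
  using card_roots_p[of n] assms card_image_le[of "{1..n}" x]
  by (intro eq_card_imp_inj_on) (auto simp: gauss_points_def)

lemma p_eq_prod_gauss_points:
  assumes "gauss_points p n x"
  obtains c where "c \<noteq> 0" "p (n + 1) = smult c (\<Prod>j\<in>{1..n}. [:- x j, 1:])"
proof -
  define P where "P = (\<Prod>j\<in>{1..n}. [:- x j, 1:])"
  have q: "p (n + 1) \<noteq> 0" by (rule p_neq_0) simp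
  have "P dvd p (n + 1)"
    unfolding P_def using inj_on_gauss_points[OF assms] assms
    by (intro prod_linear_factors_dvd) (auto simp: gauss_points_def)
  then obtain h where h: "p (n + 1) = P * h" by (elim dvdE)
  have "degree P = n" unfolding P_def by (subst degree_prod_eq_sum_degree) auto
  moreover have "degree (p (n + 1)) = degree P + degree h"
    using q unfolding h by (simp add: degree_mult_eq)
  ultimately have "degree h = 0" using degree_p[of "n + 1"] by simp
  then obtain c where "h = [:c:]" by (rule degree_eq_zeroE)
  with h q show thesis by (intro that[of c]) (auto simp: P_def)
qed

text \<open>The sum is the Christoffel-Darboux kernel with one argument fixed at \<open>a\<close>.
  This is the Christoffel-Darboux formula at a zero of \<open>p (n + 1)\<close>, with the constant
  left as \<open>L g\<close>.\<close>

lemma deflated_eq_kernel: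
  assumes g: "p (n + 1) = [:-a, 1:] * g" and "1 \<le> n"
  shows "g = smult (L g) (\<Sum>i=1..n. smult (poly (p i) a) (p i))"
proof -
  have "p (n + 1) \<noteq> 0" by (rule p_neq_0) simp
  then have "degree (p (n + 1)) = Suc (degree g)"
    unfolding g by (subst degree_mult_eq) auto
  then have deg: "degree g < n" using degree_p[of "n + 1"] by simp
  have "L (g * p i) = L g * poly (p i) a" if i: "i \<in> {1..n}" for i
  proof -
    have "poly (p i - [:poly (p i) a:]) a = 0" by simp
    then obtain u where u: "p i - [:poly (p i) a:] = [:-a, 1:] * u"
      by (metis poly_eq_0_iff_dvd dvdE)
    \<comment> \<open>Dividing by X - a lowers the degree bound \<open>i - 1\<close> by one. For
      \<open>u = 0\<close> the degree is 0 and the bound is \<open>1 \<le> n\<close>.\<close>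
    have "degree u < n"
    proof (cases "u = 0")
      case False
      then have "degree ([:-a, 1:] * u) = Suc (degree u)" by (subst degree_mult_eq) auto
      moreover have "degree (p i - [:poly (p i) a:]) \<le> i - 1"
        using i by (intro degree_diff_le) (auto simp: degree_p)
      ultimately have "Suc (degree u) \<le> i - 1" using u by simp
      then show ?thesis using i by auto
    qed (use \<open>1 \<le> n\<close> in auto)
    then have "L (p (n + 1) * u) = 0" by (rule orthogonal_lower_degree)
    \<comment> \<open>The factor X - a in front of \<open>u\<close> turns \<open>g\<close> back into
      \<open>p (n + 1)\<close>, so the first summand integrates to 0.\<close>
    moreover have "g * p i = p (n + 1) * u + smult (poly (p i) a) g"
    proof -
      have "p i = [:-a, 1:] * u + [:poly (p i) a:]" using u by (simp add: algebra_simps)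
      then have "g * p i = g * ([:-a, 1:] * u + [:poly (p i) a:])" by (rule arg_cong)
      also have "\<dots> = p (n + 1) * u + smult (poly (p i) a) g"
        unfolding g by (simp only: distrib_left mult_ac) simp
      finally show ?thesis .
    qed
    ultimately show ?thesis
      by (simp add: weighted_integral_add[OF weight] weighted_integral_smult)
  qed
  then have "g = (\<Sum>i=1..n. smult (L g * poly (p i) a) (p i))"
    using expansion[OF deg] by simp
  also have "\<dots> = smult (L g) (\<Sum>i=1..n. smult (poly (p i) a) (p i))"
    by (simp add: poly_eq_iff coeff_sum sum_distrib_left mult.assoc)
  finally show ?thesis .
qed

lemma lagrange_cardinal_eq_kernel:
  assumes x: "gauss_points p n x" and "j \<in> {1..n}"
  shows "(\<Sum>i=1..n. poly (p i) (x j) * gauss_weight p n x j * poly (p i) t) =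
    lagrange_cardinal n x j t"
proof -
  \<comment> \<open>\<open>K (x j)\<close> is the denominator of \<open>gauss_weight\<close>, so the
    left-hand side is \<open>K t / K (x j)\<close>.\<close>
  define K where "K s = (\<Sum>i=1..n. poly (p i) (x j) * poly (p i) s)" for s
  obtain c where c: "c \<noteq> 0" "p (n + 1) = smult c (\<Prod>k\<in>{1..n}. [:- x k, 1:])"
    using p_eq_prod_gauss_points[OF x] by blast
  define g where "g = smult c (\<Prod>k\<in>{1..n} - {j}. [:- x k, 1:])"
  have "p (n + 1) = [:- x j, 1:] * g"
    using assms(2) unfolding c(2) g_def by (subst prod.remove[of _ j]) auto
  then have "g = smult (L g) (\<Sum>i=1..n. smult (poly (p i) (x j)) (p i))"
    by (rule deflated_eq_kernel) (use assms(2) in auto)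
  then have gK: "poly g s = L g * K s" for s
    unfolding K_def by (metis (no_types, lifting) poly_smult poly_sum sum.cong)
  have g: "poly g s = c * (\<Prod>k\<in>{1..n} - {j}. s - x k)" for s
    by (simp add: g_def poly_prod)
  have "x j \<noteq> x k" if "k \<in> {1..n} - {j}" for k
    using inj_on_gauss_points[OF x] assms(2) that by (auto dest: inj_onD)
  then have "poly g (x j) \<noteq> 0" unfolding g using c(1) by simp
  \<comment> \<open>\<open>L g\<close> need not be computed: being nonzero, it cancels from
    \<open>poly g t / poly g (x j)\<close>, and the leading factor \<open>c\<close> cancels later in
    the same way.\<close>
  then have nz: "L g \<noteq> 0" "K (x j) \<noteq> 0" by (simp_all add: gK)
  have "(\<Sum>i=1..n. poly (p i) (x j) * gauss_weight p n x j * poly (p i) t) = K t / K (x j)"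
    by (simp add: K_def gauss_weight_def sum_divide_distrib power2_eq_square)
  also have "\<dots> = poly g t / poly g (x j)" using nz by (simp add: gK)
  also have "\<dots> = lagrange_cardinal n x j t"
    using c(1) by (simp add: g lagrange_cardinal_def prod_dividef)
  finally show ?thesis .
qed

end

section \<open>Tensor products and sparse sums\<close>

text \<open>Extensionality is vacuous over \<open>UNIV\<close>. In this form a sum over
  multi-indices of a product over variables can be factored.\<close>

lemma tensor_indices_eq_PiE: "tensor_indices N m = (\<Pi>\<^sub>E k\<in>UNIV. {1..N (m k)})"
  by (auto simp: tensor_indices_def PiE_def Pi_def)

lemma tensor_pseudospectral_eq_interpolation:
  assumes "\<And>k. orthonormal_system (S k) (w k) (p k)"
    and "\<And>k. gauss_points (p k) (N (m k)) (x k (N (m k)))"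
  shows "tensor_pseudospectral N p x m f s = tensor_interpolation N x m f s"
proof -
  have kernel: "(\<Sum>i\<in>tensor_indices N m.
      tensor_poly p i (tensor_point N x m j) * tensor_weight N p x m j * tensor_poly p i s) =
    tensor_cardinal N x m j s" (is "?l = _") if j: "j \<in> tensor_indices N m" for j
  proof -
    have "?l = (\<Sum>i\<in>(\<Pi>\<^sub>E k\<in>UNIV. {1..N (m k)}). \<Prod>k\<in>UNIV. poly (p k (i k)) (x k (N (m k)) (j k)) *
        gauss_weight (p k) (N (m k)) (x k (N (m k))) (j k) * poly (p k (i k)) (s $ k))"
      by (simp add: tensor_poly_def tensor_weight_def tensor_point_def prod.distrib
          tensor_indices_eq_PiE)
    also have "\<dots> = (\<Prod>k\<in>UNIV. \<Sum>i=1..N (m k). poly (p k i) (x k (N (m k)) (j k)) *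
        gauss_weight (p k) (N (m k)) (x k (N (m k))) (j k) * poly (p k i) (s $ k))"
      by (rule prod_sum_PiE[symmetric]) auto
    also have "\<dots> = tensor_cardinal N x m j s"
      unfolding tensor_cardinal_def
      by (intro prod.cong refl orthonormal_system.lagrange_cardinal_eq_kernel[OF assms])
        (use j in \<open>auto simp: tensor_indices_def\<close>)
    finally show ?thesis .
  qed
  \<comment> \<open>Exchanging the two sums collects everything that multiplies a single nodal value
    of \<open>f\<close>, which is the left-hand side of \<open>kernel\<close>.\<close>
  have "tensor_pseudospectral N p x m f s = (\<Sum>j\<in>tensor_indices N m. f (tensor_point N x m j) *
      (\<Sum>i\<in>tensor_indices N m.
        tensor_poly p i (tensor_point N x m j) * tensor_weight N p x m j * tensor_poly p i s))"
    unfolding tensor_pseudospectral_def pseudospectral_coeff_def sum_distrib_left sum_distrib_right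
    by (subst sum.swap) (simp add: mult.assoc)
  then show ?thesis by (simp add: kernel tensor_interpolation_def)
qed

theorem theorem1:
  fixes S :: "'d::finite \<Rightarrow> real set"
    and w :: "'d \<Rightarrow> real \<Rightarrow> real"
    and p :: "'d \<Rightarrow> nat \<Rightarrow> real poly"
    and x :: "'d \<Rightarrow> nat \<Rightarrow> nat \<Rightarrow> real"
    and N :: "nat \<Rightarrow> nat"
    and f :: "real ^ 'd \<Rightarrow> real"
    and I :: "('d \<Rightarrow> nat) set"
    and c :: "('d \<Rightarrow> nat) \<Rightarrow> real"
  assumes "\<And>k. is_interval (S k)"
    and "\<And>k. weight_function (S k) (w k)"
    and "\<And>k. orthonormal_polys (S k) (w k) (p k)"
    and "\<And>k n. n \<ge> 1 \<Longrightarrow> gauss_points (p k) n (x k n)"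
    and "\<And>m. m \<ge> 1 \<Longrightarrow> N m \<ge> 1"
    and "mono_on {1..} N"
    and "square_integrable S w f"
    and "finite I"
    and "\<And>m k. m \<in> I \<Longrightarrow> m k \<ge> 1"
  shows "\<forall>s\<in>product_domain S.
           sparse_pseudospectral N p x I c f s = sparse_interpolation N x I c f s"
proof -
  \<comment> \<open>The two approximations agree summand by summand, whatever the coefficients
    \<open>c m\<close> are.\<close>
  have "tensor_pseudospectral N p x m f s = tensor_interpolation N x m f s" if "m \<in> I" for m s
  proof (rule tensor_pseudospectral_eq_interpolation)
    show "orthonormal_system (S k) (w k) (p k)" for k
      using assms(2,3) by unfold_locales
    show "gauss_points (p k) (N (m k)) (x k (N (m k)))" for k
      using assms(4,5,9) that by blast
  qed
  then show ?thesis
    by (simp add: sparse_pseudospectral_def sparse_interpolation_def)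
qed

end
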